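(* Let $n \ge 1$, let $p_1, \dots, p_n$ be distinct prime numbers, let $k_1, \dots, k_n$ be positive integers, and let $M$ be the $\mathbb{Z}$-module $\mathbb{Z}/(p_1^{k_1} p_2^{k_2} \cdots p_n^{k_n})\mathbb{Z}$. The following statements are equivalent: (1) $M$ is semisimple; (2) $M$ is reduced; (3) $k_1 = \cdots = k_n = 1$; (4) $M$ is a torsion module, and for every prime number $p$ and every $m \in M$, if $p^2 m = 0$ then $pm = 0$.
   Context: A module is semisimple if it is a direct sum of simple modules. A module $M$ over a commutative unital ring $R$ is reduced if for all $r \in R$ and every $m \in M$, $r^2 m = 0$ implies $rm = 0$. *)

theory Defs
  imports "HOL-Algebra.Module" "HOL-Algebra.IntRing"
begin

text \<open>The zero module is not simple.\<close>

definition simple_module :: "('r, 'x) ring_scheme \<Rightarrow> ('r, 'm, 'y) module_scheme \<Rightarrow> bool" where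
  "simple_module R M \<longleftrightarrow>
     module R M \<and> carrier M \<noteq> {\<zero>\<^bsub>M\<^esub>} \<and>
     (\<forall>H. submodule H R M \<longrightarrow> H = {\<zero>\<^bsub>M\<^esub>} \<or> H = carrier M)"

text \<open>
  \<open>M\<close> is the internal direct sum of the submodules in \<open>\<S>\<close>: every element of \<open>M\<close> is, in
  exactly one way, a sum of components taken from the members of \<open>\<S>\<close>, almost all of them zero.
  The sum is taken over the support because \<^const>\<open>finsum\<close> is only meaningful on finite sets.
\<close>

definition internal_direct_sum ::
    "('r, 'x) ring_scheme \<Rightarrow> ('r, 'm, 'y) module_scheme \<Rightarrow> 'm set set \<Rightarrow> bool" where
  "internal_direct_sum R M \<S> \<longleftrightarrow>
     module R M \<and> (\<forall>H\<in>\<S>. submodule H R M) \<and>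
     (\<forall>m\<in>carrier M. \<exists>!f. f \<in> (\<Pi>\<^sub>E H\<in>\<S>. H) \<and> finite {H \<in> \<S>. f H \<noteq> \<zero>\<^bsub>M\<^esub>} \<and>
        m = (\<Oplus>\<^bsub>M\<^esub>H\<in>{H \<in> \<S>. f H \<noteq> \<zero>\<^bsub>M\<^esub>}. f H))"

text \<open>
  The summands form a set rather than an indexed family; nothing is lost, since the members of
  a family of nonzero submodules whose sum is direct are pairwise distinct.
\<close>

definition semisimple_module :: "('r, 'x) ring_scheme \<Rightarrow> ('r, 'm, 'y) module_scheme \<Rightarrow> bool" where
  "semisimple_module R M \<longleftrightarrow>
     (\<exists>\<S>. internal_direct_sum R M \<S> \<and> (\<forall>H\<in>\<S>. simple_module R (M\<lparr>carrier := H\<rparr>)))"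

definition reduced_module :: "('r, 'x) ring_scheme \<Rightarrow> ('r, 'm, 'y) module_scheme \<Rightarrow> bool" where
  "reduced_module R M \<longleftrightarrow>
     module R M \<and>
     (\<forall>r\<in>carrier R. \<forall>m\<in>carrier M.
        (r [^]\<^bsub>R\<^esub> (2::nat)) \<odot>\<^bsub>M\<^esub> m = \<zero>\<^bsub>M\<^esub> \<longrightarrow> r \<odot>\<^bsub>M\<^esub> m = \<zero>\<^bsub>M\<^esub>)"

text \<open>
  Torsion is only considered over a domain; over rings with zero divisors \<open>r\<close> would have to be
  regular instead of merely nonzero.
\<close>

definition torsion_module :: "('r, 'x) ring_scheme \<Rightarrow> ('r, 'm, 'y) module_scheme \<Rightarrow> bool" where
  "torsion_module R M \<longleftrightarrow>
     domain R \<and> module R M \<and>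
     (\<forall>m\<in>carrier M. \<exists>r\<in>carrier R. r \<noteq> \<zero>\<^bsub>R\<^esub> \<and> r \<odot>\<^bsub>M\<^esub> m = \<zero>\<^bsub>M\<^esub>)"

text \<open>
  The quotient ring \<^term>\<open>ZFact N\<close> of the integers, viewed as a module over the integers:
  \<open>r\<close> acts as multiplication by its residue class.
\<close>

definition ZFact_module :: "int \<Rightarrow> (int, int set) module" where
  "ZFact_module N =
     ring.extend (ZFact N) (module.fields (\<lambda>r X. ZMod N r \<otimes>\<^bsub>ZFact N\<^esub> X))"

lemma ZFact_module_simps [simp]:
  "carrier (ZFact_module N) = carrier (ZFact N)"
  "zero (ZFact_module N) = zero (ZFact N)"
  "add (ZFact_module N) = add (ZFact N)"
  "one (ZFact_module N) = one (ZFact N)"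
  "monoid.mult (ZFact_module N) = monoid.mult (ZFact N)"
  "smult (ZFact_module N) r X = ZMod N r \<otimes>\<^bsub>ZFact N\<^esub> X"
  by (simp_all add: ZFact_module_def ring.defs module.defs)

lemma ZMod_hom: "ZMod N \<in> ring_hom \<Z> (ZFact N)"
proof -
  interpret ideal "Idl\<^bsub>\<Z>\<^esub> {N}" \<Z>
    by (rule int.genideal_ideal) simp
  have "ZMod N = a_r_coset \<Z> (Idl\<^bsub>\<Z>\<^esub> {N})"
    by (rule ext) (simp add: ZMod_def)
  then show ?thesis
    using rcos_ring_hom by (simp add: ZFact_def)
qed

lemma carrier_ZFact: "carrier (ZFact N) = range (ZMod N)"
  by (auto simp: ZFact_def FactRing_def A_RCOSETS_def' ZMod_def)

lemma ZFact_module_smult_ZMod: "r \<odot>\<^bsub>ZFact_module N\<^esub> ZMod N a = ZMod N (r * a)"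
  using ring_hom_mult[OF ZMod_hom, of r a N] by simp

lemma module_ZFact_module: "module \<Z> (ZFact_module N)"
proof -
  interpret Q: cring "ZFact N"
    by (rule ZFact_is_cring)
  have ab: "abelian_group (ZFact_module N)"
  proof (rule abelian_groupI)
    fix X assume "X \<in> carrier (ZFact_module N)"
    then show "\<exists>Y\<in>carrier (ZFact_module N). Y \<oplus>\<^bsub>ZFact_module N\<^esub> X = \<zero>\<^bsub>ZFact_module N\<^esub>"
      by (intro bexI[of _ "a_inv (ZFact N) X"]) (simp_all add: Q.l_neg)
  qed (simp_all add: Q.a_ac)
  have closed: "ZMod N r \<in> carrier (ZFact N)" for r
    by (simp add: carrier_ZFact)
  show ?thesis
    by (rule moduleI[OF int.is_cring ab])
      (use closed ring_hom_add[OF ZMod_hom] ring_hom_mult[OF ZMod_hom] ring_hom_one[OF ZMod_hom]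
        in \<open>auto simp: Q.l_distr Q.r_distr Q.m_assoc\<close>)
qed

end

theory Submission
  imports Defs "HOL-Computational_Algebra.Squarefree"
begin

text \<open>
  All four conditions say that \<open>N = p\<^sub>1\<^bsup>k\<^sub>1\<^esup> \<cdots> p\<^sub>n\<^bsup>k\<^sub>n\<^esup>\<close> is squarefree, and the
  equivalence is proved as a cycle.

  Over every commutative ring a semisimple module is reduced. On a simple module the kernel
  of multiplication by \<open>r\<close> is a submodule, so \<open>r\<close> acts either as zero or injectively, and in
  both cases \<open>r\<^sup>2 x = 0\<close> forces \<open>r x = 0\<close>; this passes to direct sums componentwise
  (\<open>semisimple_module_imp_reduced_module\<close>).

  Reducedness contains the condition on primes in (4), and torsion is clear because \<open>N \<noteq> 0\<close>
  annihilates everything. If conversely \<open>N = q\<^sup>2 y\<close> with a prime \<open>q\<close>, then the class of \<open>y\<close>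
  is killed by \<open>q\<^sup>2\<close> but not by \<open>q\<close>; so (4) makes \<open>N\<close> squarefree.

  Finally, if \<open>N\<close> is squarefree, then \<open>\<int>/N\<int>\<close> is the direct sum of its submodules generated by the
  classes of \<open>N div q\<close>, where \<open>q\<close> ranges over the prime divisors of \<open>N\<close>
  (\<open>semisimple_ZFact_module\<close>). Each of them has order \<open>q\<close> and is therefore simple. Both existence
  and uniqueness of decompositions can be tested modulo each \<open>q\<close>, because a squarefree \<open>N\<close>
  divides whatever all its prime divisors divide, and modulo \<open>q\<close> only the summand of
  index \<open>q\<close> survives, with an invertible factor \<open>N div q\<close>.
\<close>

section \<open>Semisimple modules are reduced\<close>

lemma (in module) submodule_kernel_smult:
  assumes r: "r \<in> carrier R"
  shows "submodule {x \<in> carrier M. r \<odot>\<^bsub>M\<^esub> x = \<zero>\<^bsub>M\<^esub>} R M"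
proof (rule submoduleI)
  fix a x
  assume a: "a \<in> carrier R" and x: "x \<in> {x \<in> carrier M. r \<odot>\<^bsub>M\<^esub> x = \<zero>\<^bsub>M\<^esub>}"
  have "r \<odot>\<^bsub>M\<^esub> (a \<odot>\<^bsub>M\<^esub> x) = (r \<otimes> a) \<odot>\<^bsub>M\<^esub> x"
    using a x r by (simp add: smult_assoc1)
  also have "\<dots> = (a \<otimes> r) \<odot>\<^bsub>M\<^esub> x"
    using a r by (simp add: R.m_comm)
  also have "\<dots> = a \<odot>\<^bsub>M\<^esub> (r \<odot>\<^bsub>M\<^esub> x)"
    using a x r by (simp add: smult_assoc1)
  finally show "a \<odot>\<^bsub>M\<^esub> x \<in> {x \<in> carrier M. r \<odot>\<^bsub>M\<^esub> x = \<zero>\<^bsub>M\<^esub>}"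
    using a x by simp
qed (use r in \<open>auto simp: smult_r_distr smult_r_minus\<close>)

text \<open>
  If \<open>r\<^sup>2 x = 0\<close>, then the kernel of \<open>r\<close> contains \<open>r x\<close>. This kernel is zero or everything, and
  \<open>r x\<close> vanishes in both cases.
\<close>

lemma simple_module_imp_reduced_module:
  assumes simple: "simple_module R M"
  shows "reduced_module R M"
proof -
  interpret module R M
    using simple by (simp add: simple_module_def)
  show ?thesis
    unfolding reduced_module_def
  proof (intro conjI ballI impI)
    fix r x
    assume r: "r \<in> carrier R" and x: "x \<in> carrier M"
      and zero: "(r [^]\<^bsub>R\<^esub> (2::nat)) \<odot>\<^bsub>M\<^esub> x = \<zero>\<^bsub>M\<^esub>"
    let ?K = "{x \<in> carrier M. r \<odot>\<^bsub>M\<^esub> x = \<zero>\<^bsub>M\<^esub>}"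
    have "r \<odot>\<^bsub>M\<^esub> (r \<odot>\<^bsub>M\<^esub> x) = \<zero>\<^bsub>M\<^esub>"
      using zero r x by (simp add: numeral_2_eq_2 smult_assoc1)
    then have "r \<odot>\<^bsub>M\<^esub> x \<in> ?K"
      using r x by simp
    moreover have "?K = {\<zero>\<^bsub>M\<^esub>} \<or> ?K = carrier M"
      using simple submodule_kernel_smult[OF r] by (simp add: simple_module_def)
    ultimately show "r \<odot>\<^bsub>M\<^esub> x = \<zero>\<^bsub>M\<^esub>"
      using x by blast
  qed (rule module_axioms)
qed

lemma internal_direct_sum_independent:
  assumes sum: "internal_direct_sum R M \<S>"
    and A: "finite A" "A \<subseteq> \<S>" and x: "\<And>H. H \<in> A \<Longrightarrow> x H \<in> H"
    and zero: "(\<Oplus>\<^bsub>M\<^esub>H\<in>A. x H) = \<zero>\<^bsub>M\<^esub>" and H: "H \<in> A"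
  shows "x H = \<zero>\<^bsub>M\<^esub>"
proof -
  interpret module R M
    using sum by (simp add: internal_direct_sum_def)
  have sub: "submodule K R M" if "K \<in> \<S>" for K
    using sum that by (simp add: internal_direct_sum_def)
  have zero_in: "\<zero>\<^bsub>M\<^esub> \<in> K" if "K \<in> \<S>" for K
    using subgroup.one_closed[OF submodule.axioms(1)[OF sub[OF that]]] by simp
  have x_carrier: "x K \<in> carrier M" if "K \<in> A" for K
    using submoduleE(1)[OF sub] x that A(2) by blast
  let ?rep = "\<lambda>f. f \<in> (\<Pi>\<^sub>E K\<in>\<S>. K) \<and> finite {K \<in> \<S>. f K \<noteq> \<zero>\<^bsub>M\<^esub>} \<and>
    \<zero>\<^bsub>M\<^esub> = (\<Oplus>\<^bsub>M\<^esub>K\<in>{K \<in> \<S>. f K \<noteq> \<zero>\<^bsub>M\<^esub>}. f K)"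
  have unique: "\<exists>!f. ?rep f"
    using sum M.zero_closed unfolding internal_direct_sum_def by blast
  \<comment> \<open>Extended by zero, \<open>x\<close> represents the zero element, and so does the zero family.\<close>
  define g where "g = (\<lambda>K\<in>\<S>. if K \<in> A then x K else \<zero>\<^bsub>M\<^esub>)"
  have support: "{K \<in> \<S>. g K \<noteq> \<zero>\<^bsub>M\<^esub>} \<subseteq> A"
    by (auto simp: g_def split: if_splits)
  have "(\<Oplus>\<^bsub>M\<^esub>K\<in>A. x K) = (\<Oplus>\<^bsub>M\<^esub>K\<in>{K \<in> \<S>. g K \<noteq> \<zero>\<^bsub>M\<^esub>}. g K)"
    by (rule M.add.finprod_mono_neutral_cong_right[OF A(1) support])
      (use A(2) x_carrier in \<open>auto simp: g_def split: if_splits\<close>)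
  then have "?rep g"
    using support A(1) zero x zero_in by (auto simp: g_def intro: finite_subset)
  moreover have "?rep (\<lambda>K\<in>\<S>. \<zero>\<^bsub>M\<^esub>)"
    using zero_in by (auto cong: conj_cong)
  ultimately have "g = (\<lambda>K\<in>\<S>. \<zero>\<^bsub>M\<^esub>)"
    using unique by blast
  then have "g H = \<zero>\<^bsub>M\<^esub>"
    using H A(2) by auto
  then show ?thesis
    using H A(2) by (auto simp: g_def)
qed

text \<open>
  If \<open>r\<^sup>2 m = 0\<close>, then \<open>r\<^sup>2\<close> kills each component of \<open>m\<close> because the sum is direct; the
  components lie in simple modules, so \<open>r\<close> kills them as well.
\<close>

lemma semisimple_module_imp_reduced_module:
  assumes semisimple: "semisimple_module R M"
  shows "reduced_module R M"
proof -
  obtain \<S> where sum: "internal_direct_sum R M \<S>"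
    and simple: "\<And>H. H \<in> \<S> \<Longrightarrow> simple_module R (M\<lparr>carrier := H\<rparr>)"
    using semisimple by (auto simp: semisimple_module_def)
  interpret module R M
    using sum by (simp add: internal_direct_sum_def)
  have sub: "submodule H R M" if "H \<in> \<S>" for H
    using sum that by (simp add: internal_direct_sum_def)
  show ?thesis
    unfolding reduced_module_def
  proof (intro conjI ballI impI)
    fix r m
    assume r: "r \<in> carrier R" and m: "m \<in> carrier M"
      and zero: "(r [^]\<^bsub>R\<^esub> (2::nat)) \<odot>\<^bsub>M\<^esub> m = \<zero>\<^bsub>M\<^esub>"
    let ?s = "r [^]\<^bsub>R\<^esub> (2::nat)"
    have s: "?s \<in> carrier R"
      using r by simp
    obtain f where f: "f \<in> (\<Pi>\<^sub>E H\<in>\<S>. H)" and fin: "finite {H \<in> \<S>. f H \<noteq> \<zero>\<^bsub>M\<^esub>}"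
      and m_eq: "m = (\<Oplus>\<^bsub>M\<^esub>H\<in>{H \<in> \<S>. f H \<noteq> \<zero>\<^bsub>M\<^esub>}. f H)"
      using sum m unfolding internal_direct_sum_def by blast
    define A where "A = {H \<in> \<S>. f H \<noteq> \<zero>\<^bsub>M\<^esub>}"
    have A: "finite A" "A \<subseteq> \<S>"
      using fin by (auto simp: A_def)
    have f_in: "f H \<in> H" if "H \<in> A" for H
      using f A(2) that by (auto simp: PiE_iff)
    have f_carrier: "f \<in> A \<rightarrow> carrier M"
      using f_in submoduleE(1)[OF sub] A(2) by blast
    have killed: "?s \<odot>\<^bsub>M\<^esub> f H = \<zero>\<^bsub>M\<^esub>" if H: "H \<in> A" for H
    proof (rule internal_direct_sum_independent[OF sum A _ _ H])
      show "?s \<odot>\<^bsub>M\<^esub> f K \<in> K" if "K \<in> A" for K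
        using submoduleE(4)[OF sub s f_in] that A(2) by blast
      show "(\<Oplus>\<^bsub>M\<^esub>H\<in>A. ?s \<odot>\<^bsub>M\<^esub> f H) = \<zero>\<^bsub>M\<^esub>"
        using zero finsum_smult_ldistr[OF A(1) s f_carrier] by (simp add: m_eq A_def)
    qed
    have "r \<odot>\<^bsub>M\<^esub> f H = \<zero>\<^bsub>M\<^esub>" if "H \<in> A" for H
      using simple_module_imp_reduced_module[OF simple] killed[OF that] f_in[OF that] that A(2) r
      by (fastforce simp: reduced_module_def)
    then have "(\<Oplus>\<^bsub>M\<^esub>H\<in>A. r \<odot>\<^bsub>M\<^esub> f H) = \<zero>\<^bsub>M\<^esub>"
      by (rule M.add.finprod_one_eqI)
    then show "r \<odot>\<^bsub>M\<^esub> m = \<zero>\<^bsub>M\<^esub>"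
      using finsum_smult_ldistr[OF A(1) r f_carrier] by (simp add: m_eq A_def)
  qed (rule module_axioms)
qed

section \<open>Prime cofactors of a squarefree integer\<close>

text \<open>No prime occurs in a squarefree number more than once.\<close>

lemma squarefree_dvd_if_prime_factors_dvd:
  fixes N x :: int
  assumes N: "squarefree N" and dvd: "\<And>q. q \<in> prime_factors N \<Longrightarrow> q dvd x"
  shows "N dvd x"
proof (cases "x = 0")
  case False
  have N0: "N \<noteq> 0"
    using N by auto
  show ?thesis
  proof (rule multiplicity_le_imp_dvd[OF N0])
    fix q :: int
    assume q: "Factorial_Ring.prime q"
    show "multiplicity q N \<le> multiplicity q x"
    proof (cases "q dvd N")
      case True
      then have "multiplicity q N \<le> 1"
        using N N0 q by (simp add: squarefree_factorial_semiring'')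
      also have "q dvd x"
        using dvd True q N0 by (simp add: in_prime_factors_iff)
      then have "1 \<le> multiplicity q x"
        using False q by (intro multiplicity_geI) auto
      finally show ?thesis .
    qed (simp add: not_dvd_imp_multiplicity_0)
  qed
qed simp

lemma squarefree_coprime_cofactor:
  fixes N q :: int
  assumes N: "squarefree N" and q: "q \<in> prime_factors N"
  shows "coprime q (N div q)"
proof -
  have prime: "Factorial_Ring.prime q" and "q dvd N"
    using q by (auto simp: in_prime_factors_iff)
  then have "N = q * (N div q)"
    by simp
  then have "\<not> q dvd N div q"
    using squarefreeD[OF N, of q] prime
    by (metis dvd_triv_left mult_dvd_mono dvd_refl not_prime_unit power2_eq_square)
  then show ?thesis
    using prime by (simp add: prime_imp_coprime)
qed

lemma prime_factor_dvd_other_cofactor: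
  fixes N q r :: int
  assumes q: "q \<in> prime_factors N" and r: "r \<in> prime_factors N" and neq: "q \<noteq> r"
  shows "q dvd N div r"
proof -
  have "q dvd r * (N div r)"
    using q r by (auto simp: in_prime_factors_iff)
  moreover have "coprime q r"
    using q r neq by (intro primes_coprime) auto
  ultimately show ?thesis
    by (simp add: coprime_dvd_mult_right_iff)
qed

text \<open>
  For \<open>r \<noteq> q\<close> the cofactor \<open>N div r\<close> keeps the factor \<open>q\<close>, so modulo \<open>q\<close> the sum reduces to
  its term of index \<open>q\<close>.
\<close>

lemma prime_factor_dvd_cofactor_sum_diff:
  fixes N q :: int and c :: "int \<Rightarrow> int"
  assumes q: "q \<in> prime_factors N"
  shows "q dvd (\<Sum>r\<in>prime_factors N. N div r * c r) - N div q * c q"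
proof -
  have "(\<Sum>r\<in>prime_factors N. N div r * c r) - N div q * c q =
      (\<Sum>r\<in>prime_factors N - {q}. N div r * c r)"
    using q by (simp add: sum.remove)
  also have "q dvd \<dots>"
    using prime_factor_dvd_other_cofactor[OF q] by (intro dvd_sum) auto
  finally show ?thesis .
qed

lemma squarefree_cofactor_sum_exists:
  fixes N a :: int
  assumes N: "squarefree N"
  shows "\<exists>c. N dvd (\<Sum>q\<in>prime_factors N. N div q * c q) - a"
proof -
  have "\<exists>b. q dvd N div q * b - a" if q: "q \<in> prime_factors N" for q
  proof -
    obtain u v where uv: "u * q + v * (N div q) = 1"
      using bezout_int[of q "N div q"] squarefree_coprime_cofactor[OF N q] by auto
    \<comment> \<open>\<open>v\<close> is an inverse of the cofactor modulo \<open>q\<close>, so \<open>v * a\<close> solves the congruence.\<close>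
    have "N div q * (v * a) - a = (v * (N div q) - 1) * a"
      by (simp add: algebra_simps)
    also have "v * (N div q) - 1 = q * (- u)"
      using uv by (simp add: algebra_simps)
    finally have "q dvd N div q * (v * a) - a"
      by (simp add: mult.assoc)
    then show ?thesis ..
  qed
  then obtain c where c: "\<And>q. q \<in> prime_factors N \<Longrightarrow> q dvd N div q * c q - a"
    by metis
  have "q dvd (\<Sum>r\<in>prime_factors N. N div r * c r) - a" if q: "q \<in> prime_factors N" for q
    using dvd_add[OF prime_factor_dvd_cofactor_sum_diff[OF q, of c] c[OF q]] by simp
  then show ?thesis
    using squarefree_dvd_if_prime_factors_dvd[OF N] by blast
qed

lemma squarefree_cofactor_sum_independent:
  fixes N q :: int
  assumes N: "squarefree N" and q: "q \<in> prime_factors N"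
    and sum: "N dvd (\<Sum>r\<in>prime_factors N. N div r * c r)"
  shows "N dvd N div q * c q"
proof -
  have qN: "q dvd N"
    using q by auto
  have "q dvd N div q * c q"
    using dvd_diff[OF dvd_trans[OF qN sum] prime_factor_dvd_cofactor_sum_diff[OF q, of c]] by simp
  then have "q dvd c q"
    using squarefree_coprime_cofactor[OF N q] by (simp add: coprime_dvd_mult_right_iff)
  then have "N div q * q dvd N div q * c q"
    by (rule mult_dvd_mono[OF dvd_refl])
  then show ?thesis
    using qN by simp
qed

section \<open>Decomposition of the integers modulo a squarefree number\<close>

lemma ZMod_eq_iff_dvd_diff: "ZMod N a = ZMod N b \<longleftrightarrow> N dvd a - b"
  by (simp add: ZMod_eq_mod mod_eq_dvd_iff)

lemma zero_ZFact: "\<zero>\<^bsub>ZFact N\<^esub> = ZMod N 0"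
  using ring_hom_zero[OF ZMod_hom] int.ring_axioms cring.axioms(1)[OF ZFact_is_cring]
  by force

lemma ZMod_eq_zero_iff: "ZMod N a = \<zero>\<^bsub>ZFact N\<^esub> \<longleftrightarrow> N dvd a"
  by (simp add: zero_ZFact ZMod_eq_iff_dvd_diff)

lemma add_ZFact_ZMod: "ZMod N a \<oplus>\<^bsub>ZFact N\<^esub> ZMod N b = ZMod N (a + b)"
  using ring_hom_add[OF ZMod_hom, of a b N] by simp

lemma finsum_ZFact_module_ZMod:
  "(\<Oplus>\<^bsub>ZFact_module N\<^esub>i\<in>A. ZMod N (g i)) = ZMod N (\<Sum>i\<in>A. g i)"
proof -
  interpret module \<Z> "ZFact_module N"
    by (rule module_ZFact_module)
  show ?thesis
  proof (induction A rule: infinite_finite_induct)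
    case (insert i A)
    then show ?case
      by (simp add: carrier_ZFact add_ZFact_ZMod)
  qed (simp_all add: zero_ZFact)
qed

definition ZFact_multiples :: "int \<Rightarrow> int \<Rightarrow> int set set" where
  "ZFact_multiples N d = range (\<lambda>a. ZMod N (d * a))"

lemma submodule_ZFact_multiples: "submodule (ZFact_multiples N d) \<Z> (ZFact_module N)"
proof -
  interpret module \<Z> "ZFact_module N"
    by (rule module_ZFact_module)
  show ?thesis
  proof (rule submoduleI)
    show "\<zero>\<^bsub>ZFact_module N\<^esub> \<in> ZFact_multiples N d"
      by (auto simp: ZFact_multiples_def zero_ZFact intro: range_eqI[of _ _ 0])
    fix r X
    assume X: "X \<in> ZFact_multiples N d"
    then obtain a where a: "X = ZMod N (d * a)"
      by (auto simp: ZFact_multiples_def)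
    have smult: "r \<odot>\<^bsub>ZFact_module N\<^esub> X \<in> ZFact_multiples N d" for r
      unfolding a ZFact_module_smult_ZMod
      by (auto simp: ZFact_multiples_def mult.left_commute)
    then show "r \<odot>\<^bsub>ZFact_module N\<^esub> X \<in> ZFact_multiples N d" .
    have "X \<in> carrier (ZFact_module N)"
      by (simp add: a carrier_ZFact)
    then have "\<ominus>\<^bsub>ZFact_module N\<^esub> X = (-1) \<odot>\<^bsub>ZFact_module N\<^esub> X"
      using smult_l_minus[of 1 X] smult_one[of X] by (simp del: ZFact_module_simps(6))
    then show "\<ominus>\<^bsub>ZFact_module N\<^esub> X \<in> ZFact_multiples N d"
      using smult by simp
  qed (auto simp: ZFact_multiples_def carrier_ZFact add_ZFact_ZMod distrib_left[symmetric])
qed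

text \<open>
  The submodule generated by \<open>d\<close> in \<open>\<int>/dq\<int>\<close> has prime order \<open>q\<close>. A multiple \<open>d a\<close> that is nonzero
  there has \<open>a\<close> coprime to \<open>q\<close>, so a Bezout relation between \<open>a\<close> and \<open>q\<close> recovers the
  generator \<open>d\<close> from it.
\<close>

lemma simple_ZFact_multiples:
  fixes d q :: int
  assumes q: "Factorial_Ring.prime q" and d: "d \<noteq> 0" and N: "N = d * q"
  shows "simple_module \<Z> ((ZFact_module N)\<lparr>carrier := ZFact_multiples N d\<rparr>)"
  unfolding simple_module_def
proof (intro conjI allI impI)
  let ?H = "ZFact_multiples N d"
  let ?M = "(ZFact_module N)\<lparr>carrier := ?H\<rparr>"
  show mod: "module \<Z> ?M"
    by (rule submodule.submodule_is_module[OF submodule_ZFact_multiples module_ZFact_module])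
  have "\<not> q dvd 1"
    using q not_prime_unit by blast
  then have "\<not> N dvd d"
    using d dvd_mult_cancel_left[of d q 1] unfolding N by simp
  moreover have "ZMod N d \<in> ?H"
    by (auto simp: ZFact_multiples_def intro: range_eqI[of _ _ 1])
  ultimately show "carrier ?M \<noteq> {\<zero>\<^bsub>?M\<^esub>}"
    by (auto simp flip: ZMod_eq_zero_iff)
  fix K
  assume K: "submodule K \<Z> ?M"
  have K_sub: "K \<subseteq> ?H"
    using module.submoduleE(1)[OF mod K] by simp
  have K_smult: "ZMod N (r * a) \<in> K" if "ZMod N a \<in> K" for r a
    using module.submoduleE(4)[OF mod K, of r "ZMod N a"] that
    by (simp add: ring_hom_mult[OF ZMod_hom, symmetric, of r a N, simplified] ZFact_module_smult_ZMod[simplified])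
  have K_zero: "\<zero>\<^bsub>ZFact N\<^esub> \<in> K"
    using subgroup.one_closed[OF submodule.axioms(1)[OF K]] by simp
  show "K = {\<zero>\<^bsub>?M\<^esub>} \<or> K = carrier ?M"
  proof (cases "K \<subseteq> {\<zero>\<^bsub>ZFact N\<^esub>}")
    case False
    then obtain X where X: "X \<in> K" "X \<noteq> \<zero>\<^bsub>ZFact N\<^esub>"
      by blast
    moreover have "X \<in> ?H"
      using K_sub X(1) by blast
    ultimately obtain a where a: "ZMod N (d * a) \<in> K" and nz: "ZMod N (d * a) \<noteq> \<zero>\<^bsub>ZFact N\<^esub>"
      unfolding ZFact_multiples_def by blast
    have "\<not> q dvd a"
      using nz d by (simp add: ZMod_eq_zero_iff N)
    then have "coprime q a"
      using q by (simp add: prime_imp_coprime)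
    then obtain u v where uv: "u * q + v * a = 1"
      using bezout_int[of q a] by auto
    have "ZMod N (d * b) \<in> K" for b
    proof -
      have "b * v * (d * a) - d * b = d * b * (v * a - 1)"
        by (simp add: algebra_simps)
      also have "v * a - 1 = - (u * q)"
        using uv by simp
      also have "d * b * (- (u * q)) = N * (- (b * u))"
        by (simp add: N algebra_simps)
      finally have "N dvd b * v * (d * a) - d * b"
        by (metis dvd_triv_left)
      then have "ZMod N (d * b) = ZMod N (b * v * (d * a))"
        by (simp add: ZMod_eq_iff_dvd_diff dvd_diff_commute)
      then show ?thesis
        using K_smult[OF a] by simp
    qed
    then have "?H \<subseteq> K"
      by (auto simp: ZFact_multiples_def)
    then show ?thesis
      using K_sub by auto
  qed (use K_zero in auto)
qed

text \<open>
  A direct sum is taken over a set of submodules, so distinct primes must give distinct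
  summands before sums over the summands can be rewritten as sums over the primes. If those
  of \<open>q\<close> and \<open>r\<close> coincided, \<open>N div q\<close> would be a multiple of \<open>N div r\<close> modulo \<open>N\<close>, hence
  divisible by \<open>q\<close>.
\<close>

lemma inj_on_ZFact_multiples_cofactor:
  fixes N :: int
  assumes N: "squarefree N"
  shows "inj_on (\<lambda>q. ZFact_multiples N (N div q)) (prime_factors N)"
proof (rule inj_onI, rule ccontr)
  fix q r
  assume q: "q \<in> prime_factors N" and r: "r \<in> prime_factors N" and neq: "q \<noteq> r"
    and eq: "ZFact_multiples N (N div q) = ZFact_multiples N (N div r)"
  have "ZMod N (N div q) \<in> ZFact_multiples N (N div q)"
    by (auto simp: ZFact_multiples_def intro: range_eqI[of _ _ 1])
  then obtain a where "N dvd N div q - N div r * a"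
    using eq by (auto simp: ZFact_multiples_def ZMod_eq_iff_dvd_diff)
  then have "q dvd N div q - N div r * a"
    using q dvd_trans by blast
  moreover have "q dvd N div r * a"
    using prime_factor_dvd_other_cofactor[OF q r neq] by simp
  ultimately have "q dvd N div q"
    by (metis dvd_add diff_add_cancel)
  then have "is_unit q"
    using squarefree_coprime_cofactor[OF N q] by (meson coprime_common_divisor dvd_refl)
  then show False
    using in_prime_factors_imp_prime[OF q] not_prime_unit by blast
qed

lemma semisimple_ZFact_module:
  assumes N: "squarefree N"
  shows "semisimple_module \<Z> (ZFact_module N)"
proof -
  interpret module \<Z> "ZFact_module N"
    by (rule module_ZFact_module)
  define P where "P = prime_factors N"
  define H where "H = (\<lambda>q. ZFact_multiples N (N div q))"
  have sub: "submodule (H q) \<Z> (ZFact_module N)" for q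
    by (simp add: H_def submodule_ZFact_multiples)
  have inj: "inj_on H P"
    using inj_on_ZFact_multiples_cofactor[OF N] unfolding H_def P_def .
  have finP: "finite P"
    by (simp add: P_def)

  have sum_eq: "(\<Oplus>\<^bsub>ZFact_module N\<^esub>K\<in>{K \<in> H ` P. f K \<noteq> \<zero>\<^bsub>ZFact_module N\<^esub>}. f K) =
      ZMod N (\<Sum>q\<in>P. N div q * c q)"
    if fc: "\<And>q. q \<in> P \<Longrightarrow> f (H q) = ZMod N (N div q * c q)" for f c
  proof -
    have carrier: "f \<in> H ` P \<rightarrow> carrier (ZFact_module N)"
      by (auto simp: fc carrier_ZFact)
    have "(\<Oplus>\<^bsub>ZFact_module N\<^esub>K\<in>{K \<in> H ` P. f K \<noteq> \<zero>\<^bsub>ZFact_module N\<^esub>}. f K) =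
        (\<Oplus>\<^bsub>ZFact_module N\<^esub>K\<in>H ` P. f K)"
      by (rule M.add.finprod_mono_neutral_cong_left) (use finP carrier in auto)
    also have "\<dots> = (\<Oplus>\<^bsub>ZFact_module N\<^esub>q\<in>P. f (H q))"
      by (rule M.add.finprod_reindex[OF carrier inj])
    also have "\<dots> = (\<Oplus>\<^bsub>ZFact_module N\<^esub>q\<in>P. ZMod N (N div q * c q))"
      by (rule M.add.finprod_cong') (auto simp: fc carrier_ZFact)
    also have "\<dots> = ZMod N (\<Sum>q\<in>P. N div q * c q)"
      by (rule finsum_ZFact_module_ZMod)
    finally show ?thesis .
  qed

  have coefficients: "\<exists>c. \<forall>q\<in>P. f (H q) = ZMod N (N div q * c q)"
    if "f \<in> (\<Pi>\<^sub>E K\<in>H ` P. K)" for f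
  proof -
    have "f (H q) \<in> H q" if "q \<in> P" for q
      using \<open>f \<in> (\<Pi>\<^sub>E K\<in>H ` P. K)\<close> that by (auto simp: PiE_iff)
    then have "\<forall>q\<in>P. \<exists>b. f (H q) = ZMod N (N div q * b)"
      by (auto simp: H_def ZFact_multiples_def)
    then show ?thesis
      by (rule bchoice)
  qed

  have "internal_direct_sum \<Z> (ZFact_module N) (H ` P)"
    unfolding internal_direct_sum_def
  proof (intro conjI ballI)
    fix m
    assume "m \<in> carrier (ZFact_module N)"
    then obtain a where m: "m = ZMod N a"
      by (auto simp: carrier_ZFact)
    obtain c where c: "N dvd (\<Sum>q\<in>P. N div q * c q) - a"
      using squarefree_cofactor_sum_exists[OF N] by (auto simp: P_def)
    \<comment> \<open>Components are indexed by the submodules themselves; the inverse of \<open>H\<close> recovers the prime.\<close>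
    define f where "f = (\<lambda>K\<in>H ` P. ZMod N (N div the_inv_into P H K * c (the_inv_into P H K)))"
    have f_eq: "f (H q) = ZMod N (N div q * c q)" if "q \<in> P" for q
      using that by (simp add: f_def the_inv_into_f_f[OF inj])
    show "\<exists>!f. f \<in> (\<Pi>\<^sub>E K\<in>H ` P. K) \<and>
        finite {K \<in> H ` P. f K \<noteq> \<zero>\<^bsub>ZFact_module N\<^esub>} \<and>
        m = (\<Oplus>\<^bsub>ZFact_module N\<^esub>K\<in>{K \<in> H ` P. f K \<noteq> \<zero>\<^bsub>ZFact_module N\<^esub>}. f K)"
    proof (rule ex_ex1I)
      have "f \<in> (\<Pi>\<^sub>E K\<in>H ` P. K)"
      proof (rule PiE_I)
        show "f K \<in> K" if "K \<in> H ` P" for K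
          using that f_eq by (auto simp: H_def ZFact_multiples_def)
      qed (simp add: f_def)
      moreover have "m = (\<Oplus>\<^bsub>ZFact_module N\<^esub>K\<in>{K \<in> H ` P. f K \<noteq> \<zero>\<^bsub>ZFact_module N\<^esub>}. f K)"
        using c by (simp only: sum_eq[OF f_eq] m ZMod_eq_iff_dvd_diff dvd_diff_commute)
      ultimately show "\<exists>f. f \<in> (\<Pi>\<^sub>E K\<in>H ` P. K) \<and>
          finite {K \<in> H ` P. f K \<noteq> \<zero>\<^bsub>ZFact_module N\<^esub>} \<and>
          m = (\<Oplus>\<^bsub>ZFact_module N\<^esub>K\<in>{K \<in> H ` P. f K \<noteq> \<zero>\<^bsub>ZFact_module N\<^esub>}. f K)"
        using finP by (intro exI[of _ f]) auto
    next
      fix f g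
      assume f: "f \<in> (\<Pi>\<^sub>E K\<in>H ` P. K) \<and> finite {K \<in> H ` P. f K \<noteq> \<zero>\<^bsub>ZFact_module N\<^esub>} \<and>
          m = (\<Oplus>\<^bsub>ZFact_module N\<^esub>K\<in>{K \<in> H ` P. f K \<noteq> \<zero>\<^bsub>ZFact_module N\<^esub>}. f K)"
        and g: "g \<in> (\<Pi>\<^sub>E K\<in>H ` P. K) \<and> finite {K \<in> H ` P. g K \<noteq> \<zero>\<^bsub>ZFact_module N\<^esub>} \<and>
          m = (\<Oplus>\<^bsub>ZFact_module N\<^esub>K\<in>{K \<in> H ` P. g K \<noteq> \<zero>\<^bsub>ZFact_module N\<^esub>}. g K)"
      obtain c where c: "\<And>q. q \<in> P \<Longrightarrow> f (H q) = ZMod N (N div q * c q)"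
        using coefficients[OF conjunct1[OF f]] by blast
      obtain d where d: "\<And>q. q \<in> P \<Longrightarrow> g (H q) = ZMod N (N div q * d q)"
        using coefficients[OF conjunct1[OF g]] by blast
      have "m = ZMod N (\<Sum>q\<in>P. N div q * c q)"
        using f sum_eq[of f c, OF c] by (elim conjE) (rule trans)
      moreover have "m = ZMod N (\<Sum>q\<in>P. N div q * d q)"
        using g sum_eq[of g d, OF d] by (elim conjE) (rule trans)
      ultimately have "ZMod N (\<Sum>q\<in>P. N div q * c q) = ZMod N (\<Sum>q\<in>P. N div q * d q)"
        by (rule subst)
      then have sum: "N dvd (\<Sum>q\<in>P. N div q * (c q - d q))"
        by (simp add: ZMod_eq_iff_dvd_diff right_diff_distrib sum_subtractf)
      have "f (H q) = g (H q)" if "q \<in> P" for q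
        using squarefree_cofactor_sum_independent[OF N, of q "\<lambda>q. c q - d q"] sum that c d
        by (simp add: P_def ZMod_eq_iff_dvd_diff right_diff_distrib)
      then show "f = g"
        using PiE_ext[OF conjunct1[OF f] conjunct1[OF g]] by blast
    qed
  qed (use sub module_ZFact_module in auto)
  moreover have "simple_module \<Z> ((ZFact_module N)\<lparr>carrier := K\<rparr>)" if K_in: "K \<in> H ` P" for K
  proof -
    obtain q where q: "q \<in> prime_factors N" and K: "K = ZFact_multiples N (N div q)"
      using K_in unfolding H_def P_def by blast
    then have prime: "Factorial_Ring.prime q" and "q dvd N" and "N \<noteq> 0"
      by (auto simp: in_prime_factors_iff)
    then have "N div q \<noteq> 0" "N = N div q * q"
      by (simp_all add: dvd_div_eq_0_iff)
    then show ?thesis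
      unfolding K by (rule simple_ZFact_multiples[OF prime])
  qed
  ultimately show ?thesis
    unfolding semisimple_module_def by blast
qed

section \<open>The four conditions\<close>

lemma reduced_module_square:
  assumes "reduced_module \<Z> M" "m \<in> carrier M" "r\<^sup>2 \<odot>\<^bsub>M\<^esub> m = \<zero>\<^bsub>M\<^esub>"
  shows "r \<odot>\<^bsub>M\<^esub> m = \<zero>\<^bsub>M\<^esub>"
proof -
  have "r [^]\<^bsub>\<Z>\<^esub> (2::nat) = r\<^sup>2"
    by (simp add: nat_pow_def power2_eq_square numeral_2_eq_2)
  moreover have "r \<in> carrier \<Z>"
    by simp
  ultimately show ?thesis
    using assms unfolding reduced_module_def by metis
qed

lemma torsion_ZFact_module:
  assumes "N \<noteq> 0"
  shows "torsion_module \<Z> (ZFact_module N)"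
  unfolding torsion_module_def
proof (intro conjI ballI)
  fix m
  assume "m \<in> carrier (ZFact_module N)"
  then obtain a where "m = ZMod N a"
    by (auto simp: carrier_ZFact)
  then have "N \<odot>\<^bsub>ZFact_module N\<^esub> m = \<zero>\<^bsub>ZFact_module N\<^esub>"
    by (simp only: ZFact_module_smult_ZMod ZFact_module_simps(2) ZMod_eq_zero_iff dvd_triv_left)
  then show "\<exists>r\<in>carrier \<Z>. r \<noteq> \<zero>\<^bsub>\<Z>\<^esub> \<and> r \<odot>\<^bsub>ZFact_module N\<^esub> m = \<zero>\<^bsub>ZFact_module N\<^esub>"
    using assms by (intro bexI[of _ N]) simp_all
qed (rule int.domain_axioms module_ZFact_module)+

text \<open>If \<open>N = q\<^sup>2 y\<close>, then \<open>q\<^sup>2\<close> kills the class of \<open>y\<close>, whereas \<open>q\<close> does not.\<close>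

lemma squarefree_if_ZFact_module_prime_reduced:
  assumes N: "N \<noteq> 0"
    and reduced: "\<And>(q::nat) m. Factorial_Ring.prime q \<Longrightarrow> m \<in> carrier (ZFact_module N) \<Longrightarrow>
      (int q)\<^sup>2 \<odot>\<^bsub>ZFact_module N\<^esub> m = \<zero>\<^bsub>ZFact_module N\<^esub> \<Longrightarrow>
      int q \<odot>\<^bsub>ZFact_module N\<^esub> m = \<zero>\<^bsub>ZFact_module N\<^esub>"
  shows "squarefree N"
  unfolding squarefree_factorial_semiring[OF N]
proof (intro allI impI notI)
  fix p :: int
  assume p: "Factorial_Ring.prime p" and "p\<^sup>2 dvd N"
  then obtain y where y: "N = p\<^sup>2 * y"
    by blast
  obtain q :: nat where q: "p = int q"
    using p prime_ge_0_int nonneg_int_cases by metis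
  have "int q \<odot>\<^bsub>ZFact_module N\<^esub> ZMod N y = \<zero>\<^bsub>ZFact_module N\<^esub>"
  proof (rule reduced)
    show "Factorial_Ring.prime q"
      using p by (simp add: q)
    show "(int q)\<^sup>2 \<odot>\<^bsub>ZFact_module N\<^esub> ZMod N y = \<zero>\<^bsub>ZFact_module N\<^esub>"
      by (simp only: ZFact_module_smult_ZMod ZFact_module_simps(2) ZMod_eq_zero_iff y q dvd_refl)
  qed (simp add: carrier_ZFact)
  then have "N dvd p * y"
    by (simp only: ZFact_module_smult_ZMod ZFact_module_simps(2) ZMod_eq_zero_iff q)
  then have "p dvd 1"
    using N by (simp add: y power2_eq_square mult.assoc)
  then show False
    using p not_prime_unit by blast
qed

lemma squarefree_prod_prime_powers_iff:
  fixes p :: "'i \<Rightarrow> 'a :: factorial_semiring_gcd"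
  assumes fin: "finite I" and prime: "\<And>i. i \<in> I \<Longrightarrow> Factorial_Ring.prime (p i)"
    and inj: "inj_on p I" and pos: "\<And>i. i \<in> I \<Longrightarrow> k i > 0"
  shows "squarefree (\<Prod>i\<in>I. p i ^ k i) \<longleftrightarrow> (\<forall>i\<in>I. k i = 1)"
proof
  assume sf: "squarefree (\<Prod>i\<in>I. p i ^ k i)"
  show "\<forall>i\<in>I. k i = 1"
  proof
    fix i
    assume i: "i \<in> I"
    have "squarefree (p i ^ k i)"
      using fin i sf by (meson dvd_prodI squarefree_mono)
    then show "k i = 1"
      using prime[OF i] pos[OF i] by (auto simp: squarefree_power_iff not_prime_unit)
  qed
next
  assume k: "\<forall>i\<in>I. k i = 1"
  have "squarefree (\<Prod>i\<in>I. p i)"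
    using prime inj by (intro squarefree_prod_coprime primes_coprime squarefree_prime) (auto dest: inj_onD)
  then show "squarefree (\<Prod>i\<in>I. p i ^ k i)"
    using k by simp
qed

theorem theorem3p1:
  fixes n :: nat and p k :: "nat \<Rightarrow> nat" and M :: "(int, int set) module"
  assumes "n \<ge> 1"
    and "\<And>i. i \<in> {1..n} \<Longrightarrow> Factorial_Ring.prime (p i)"
    and "inj_on p {1..n}"
    and "\<And>i. i \<in> {1..n} \<Longrightarrow> k i > 0"
    and "M = ZFact_module (int (\<Prod>i\<in>{1..n}. p i ^ k i))"
  shows "(semisimple_module \<Z> M \<longleftrightarrow> reduced_module \<Z> M) \<and>
    (reduced_module \<Z> M \<longleftrightarrow> (\<forall>i\<in>{1..n}. k i = 1)) \<and>
    ((\<forall>i\<in>{1..n}. k i = 1) \<longleftrightarrow>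
       torsion_module \<Z> M \<and>
       (\<forall>q::nat. Factorial_Ring.prime q \<longrightarrow>
          (\<forall>m\<in>carrier M. (int q)^2 \<odot>\<^bsub>M\<^esub> m = \<zero>\<^bsub>M\<^esub> \<longrightarrow> int q \<odot>\<^bsub>M\<^esub> m = \<zero>\<^bsub>M\<^esub>)))"
proof -
  define N where "N = int (\<Prod>i\<in>{1..n}. p i ^ k i)"
  have M: "M = ZFact_module N"
    using assms(5) by (simp add: N_def)
  have N0: "N \<noteq> 0"
  proof -
    have "p i \<noteq> 0" if "i \<in> {1..n}" for i
      using assms(2)[OF that] by (metis not_prime_0)
    then show ?thesis
      by (simp add: N_def)
  qed
  have squarefree: "squarefree N \<longleftrightarrow> (\<forall>i\<in>{1..n}. k i = 1)"
  proof -
    have "N = (\<Prod>i\<in>{1..n}. int (p i) ^ k i)"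
      by (simp add: N_def)
    moreover have "inj_on (\<lambda>i. int (p i)) {1..n}"
      using comp_inj_on[OF assms(3), of int] by (simp add: comp_def)
    ultimately show ?thesis
      using squarefree_prod_prime_powers_iff[of "{1..n}" "\<lambda>i. int (p i)" k] assms(2,4) by simp
  qed
  let ?four = "torsion_module \<Z> M \<and>
    (\<forall>q::nat. Factorial_Ring.prime q \<longrightarrow>
      (\<forall>m\<in>carrier M. (int q)^2 \<odot>\<^bsub>M\<^esub> m = \<zero>\<^bsub>M\<^esub> \<longrightarrow> int q \<odot>\<^bsub>M\<^esub> m = \<zero>\<^bsub>M\<^esub>))"
  have "semisimple_module \<Z> M \<Longrightarrow> reduced_module \<Z> M"
    by (rule semisimple_module_imp_reduced_module)
  moreover have "reduced_module \<Z> M \<Longrightarrow> ?four"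
    unfolding M by (intro conjI allI ballI impI torsion_ZFact_module[OF N0]) (rule reduced_module_square)
  moreover have "?four \<Longrightarrow> squarefree N"
    unfolding M by (rule squarefree_if_ZFact_module_prime_reduced[OF N0]) (elim conjE allE impE, assumption, drule (1) bspec, drule (1) mp)
  moreover have "squarefree N \<Longrightarrow> semisimple_module \<Z> M"
    unfolding M by (rule semisimple_ZFact_module)
  ultimately show ?thesis
    using squarefree by argo
qed

end
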